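(* Assume that for every $x\in\mathcal X$ the function $f(x,\cdot)$ is concave on $\mathcal Y$ (no convexity of $f(\cdot,y)$ is assumed) and that $f$ satisfies the Lipschitz gradient assumption with constants $L_{11},L_{12},L_{21},L_{22}>0$. Let $\{c_k\}_{k\ge1}$ be a nonnegative monotonically decreasing sequence, let $\bar\eta,\bar\rho>0$ be constants, $\{\bar\beta_k\}_{k\ge1}$ real numbers, and let $\{(x_k,y_k)\}_{k\ge1}$ be generated from $(x_1,y_1)\in\mathcal X\times\mathcal Y$ by $$x_{k+1}=\mathcal P_{\mathcal X}\Big(x_k-\tfrac1{\bar\eta+\bar\beta_k}\nabla_xf(x_k,y_k)\Big),\qquad y_{k+1}=\mathcal P_{\mathcal Y}\big(y_k+\bar\rho\nabla_yf(x_{k+1},y_k)-\bar\rho c_ky_k\big),\quad k\ge1.$$ Put $L_{22}'=L_{22}+c_1$. If $\bar\beta_k>L_{11}$ for all $k$ and $\bar\rho\le\frac2{L_{22}'+c_1}$, then for all $k\ge2$, $$f(x_{k+1},y_{k+1})-f(x_k,y_k)\le-\Big(\bar\eta+\frac{\bar\beta_k}{2}-\frac{\bar\rho L_{12}^2}{2}\Big)\|x_{k+1}-x_k\|^2+\frac1{\bar\rho}\|y_{k+1}-y_k\|^2+\frac1{2\bar\rho}\|y_k-y_{k-1}\|^2+\frac{c_{k-1}}{2}\big(\|y_{k+1}\|^2-\|y_k\|^2\big).$$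
   Context: $\mathcal X\subseteq\mathbb R^n$ and $\mathcal Y\subseteq\mathbb R^m$ are nonempty closed bounded convex sets and $f:\mathcal X\times\mathcal Y\to\mathbb R$ is a smooth function. $\|\cdot\|$ is the Euclidean norm; $\mathcal P_{\mathcal X},\mathcal P_{\mathcal Y}$ are Euclidean projections. Lipschitz gradient assumption: for all $x,\bar x\in\mathcal X$, $y,\bar y\in\mathcal Y$: $\|\nabla_xf(x,y)-\nabla_xf(\bar x,y)\|\le L_{11}\|x-\bar x\|$, $\|\nabla_xf(x,y)-\nabla_xf(x,\bar y)\|\le L_{21}\|y-\bar y\|$, $\|\nabla_yf(x,y)-\nabla_yf(x,\bar y)\|\le L_{22}\|y-\bar y\|$, $\|\nabla_yf(x,y)-\nabla_yf(\bar x,y)\|\le L_{12}\|x-\bar x\|$. *)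

theory Defs
  imports "HOL-Analysis.Analysis"
begin

text \<open>
  \<open>C1_with_gradients f gx gy X Y\<close>: the function \<open>f\<close> on \<open>X \<times> Y\<close> is smooth, i.e. continuously
  differentiable, with partial gradients \<open>gx\<close> and \<open>gy\<close>. Differentiability is taken within
  \<open>X \<times> Y\<close>, so that only the values of \<open>f\<close> on \<open>X \<times> Y\<close> matter, as for a function
  \<open>f : X \<times> Y \<rightarrow> \<real>\<close>. If \<open>f\<close> is continuously differentiable on an open neighbourhood of \<open>X \<times> Y\<close>,
  its ordinary partial gradients satisfy this predicate. If \<open>X\<close> and \<open>Y\<close> have nonempty interior
  (and are convex), the predicate determines \<open>gx\<close> and \<open>gy\<close> on \<open>X \<times> Y\<close>; otherwise the components
  of the gradients orthogonal to the affine hulls of \<open>X\<close> and \<open>Y\<close> are left open, and a theorem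
  assuming the predicate speaks about every choice of them.
\<close>

definition C1_with_gradients ::
  "('a::euclidean_space \<times> 'b::euclidean_space \<Rightarrow> real) \<Rightarrow> ('a \<times> 'b \<Rightarrow> 'a) \<Rightarrow> ('a \<times> 'b \<Rightarrow> 'b)
    \<Rightarrow> 'a set \<Rightarrow> 'b set \<Rightarrow> bool"
  where
  "C1_with_gradients f gx gy X Y \<longleftrightarrow>
     (\<forall>x\<in>X. \<forall>y\<in>Y.
        (f has_derivative (\<lambda>(h, k). gx (x, y) \<bullet> h + gy (x, y) \<bullet> k)) (at (x, y) within X \<times> Y)) \<and>
     continuous_on (X \<times> Y) gx \<and> continuous_on (X \<times> Y) gy"

end

theory Submission
  imports Defs
begin

text \<open>
  The \<open>x\<close>-step is the usual projected-gradient descent estimate. For the \<open>y\<close>-step, concavity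
  bounds the increase by \<open>gy (x\<^sub>k\<^sub>+\<^sub>1, y\<^sub>k) \<bullet> (y\<^sub>k\<^sub>+\<^sub>1 - y\<^sub>k)\<close>; comparing with the variational inequality
  of the previous projection leaves the term
  \<open>(e + \<rho> (w - c\<^sub>k\<^sub>-\<^sub>1 e)) \<bullet> (y\<^sub>k\<^sub>+\<^sub>1 - y\<^sub>k)\<close> with \<open>e = y\<^sub>k - y\<^sub>k\<^sub>-\<^sub>1\<close> and \<open>w\<close> the corresponding gradient
  difference. The step size condition makes \<open>v \<mapsto> v + \<rho> (gy (x\<^sub>k, v) - c\<^sub>k\<^sub>-\<^sub>1 v)\<close> nonexpansive
  provided that the gradient is cocoercive on \<open>Y\<close>. The textbook proof of cocoercivity evaluates the function at
  \<open>u + (g u - g v) / L\<close>, which need not lie in \<open>Y\<close>. It does if \<open>u\<close> and \<open>v\<close> are close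
  together in the relative interior and \<open>g\<close> is tangent to the affine hull. Cocoercivity means that
  \<open>id + (2 / L) g\<close> is nonexpansive, which extends from close points to all points by subdividing
  segments, and then to \<open>Y\<close> by continuity.
\<close>

section \<open>First-order inequalities on convex sets\<close>

lemma has_derivative_along_segment:
  fixes \<phi> :: "'a::real_normed_vector \<Rightarrow> real"
  assumes S: "convex S" "u \<in> S" "z \<in> S" and t: "t \<in> {0..1}"
    and der: "(\<phi> has_derivative D) (at (u + t *\<^sub>R (z - u)) within S)"
  shows "((\<lambda>t. \<phi> (u + t *\<^sub>R (z - u))) has_derivative (\<lambda>s. D (s *\<^sub>R (z - u)))) (at t within {0..1})"
proof -
  have "u + s *\<^sub>R (z - u) \<in> S" if "s \<in> {0..1}" for s
    using convexD_alt[OF S, of s] that by (simp add: algebra_simps)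
  then have sub: "(\<lambda>t. u + t *\<^sub>R (z - u)) ` {0..1} \<subseteq> S"
    by blast
  have "((\<lambda>t. u + t *\<^sub>R (z - u)) has_derivative (\<lambda>s. s *\<^sub>R (z - u))) (at t within {0..1})"
    by (auto intro!: derivative_eq_intros)
  from has_derivative_in_compose[OF this has_derivative_subset[OF der sub]] show ?thesis .
qed

text \<open>The mean value theorem on the segment from \<open>u\<close> to \<open>z\<close> reduces
  the bound to the sign of one derivative, settled by Cauchy-Schwarz and the Lipschitz
  condition.\<close>

lemma lipschitz_gradient_quadratic_upper_bound:
  fixes \<phi> :: "'a::real_inner \<Rightarrow> real"
  assumes S: "convex S" "u \<in> S" "z \<in> S"
    and der: "\<And>p. p \<in> S \<Longrightarrow> (\<phi> has_derivative (\<lambda>h. g p \<bullet> h)) (at p within S)"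
    and lip: "\<And>p q. p \<in> S \<Longrightarrow> q \<in> S \<Longrightarrow> norm (g p - g q) \<le> L * norm (p - q)"
  shows "\<phi> z \<le> \<phi> u + g u \<bullet> (z - u) + L / 2 * (norm (z - u))\<^sup>2"
proof -
  define d where "d = z - u"
  \<comment> \<open>The linear and quadratic terms of the bound are subtracted along the segment, so
    that the claim reads \<open>h 1 \<le> h 0\<close>.\<close>
  define h where "h t = \<phi> (u + t *\<^sub>R d) - t * (g u \<bullet> d) - L / 2 * t\<^sup>2 * (norm d)\<^sup>2" for t
  define h' where "h' t s = g (u + t *\<^sub>R d) \<bullet> (s *\<^sub>R d) - s * (g u \<bullet> d) - L * t * s * (norm d)\<^sup>2" for t s :: real
  have inS: "u + t *\<^sub>R d \<in> S" if "t \<in> {0..1}" for t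
    using convexD_alt[OF S, of t] that by (simp add: d_def algebra_simps)
  have "(h has_derivative h' t) (at t within {0..1})" if t: "0 \<le> t" "t \<le> 1" for t
  proof -
    note [derivative_intros] =
      has_derivative_along_segment[OF S _ der[OF inS, unfolded d_def], folded d_def]
    show ?thesis
      unfolding h_def h'_def using t
      by (auto intro!: derivative_eq_intros simp: algebra_simps)
  qed
  then obtain t where t: "t \<in> {0<..<1}" and eq: "h 1 - h 0 = h' t (1 - 0)"
    using mvt_simple[of 0 1 h h'] by auto
  have "(g (u + t *\<^sub>R d) - g u) \<bullet> d \<le> norm (g (u + t *\<^sub>R d) - g u) * norm d"
    by (rule norm_cauchy_schwarz)
  also have "\<dots> \<le> L * norm (t *\<^sub>R d) * norm d"
    using lip[OF inS[of t] S(2)] t by (intro mult_right_mono) auto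
  also have "\<dots> = L * t * (norm d)\<^sup>2"
    using t by (simp add: power2_eq_square)
  finally have "h' t 1 \<le> 0"
    by (simp add: h'_def inner_diff_left)
  with eq show ?thesis
    by (simp add: h_def d_def)
qed

text \<open>By concavity each difference quotient on the segment is at least
  \<open>\<phi> z - \<phi> u\<close>, and the quotients tend to \<open>D (z - u)\<close> at
  \<open>u\<close>.\<close>

lemma concave_below_tangent:
  fixes \<phi> :: "'a::real_normed_vector \<Rightarrow> real"
  assumes S: "convex S" "u \<in> S" "z \<in> S"
    and conc: "concave_on S \<phi>"
    and der: "(\<phi> has_derivative D) (at u within S)"
  shows "\<phi> z \<le> \<phi> u + D (z - u)"
proof -
  interpret D: bounded_linear D
    using der by (rule has_derivative_bounded_linear)
  have "((\<lambda>t. \<phi> (u + t *\<^sub>R (z - u))) has_derivative (\<lambda>s. D (s *\<^sub>R (z - u)))) (at 0 within {0..1})"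
    by (rule has_derivative_along_segment[OF S]) (use der in auto)
  then have "((\<lambda>t. \<phi> (u + t *\<^sub>R (z - u))) has_field_derivative D (z - u)) (at 0 within {0..1})"
    by (simp add: has_field_derivative_def D.scaleR mult_commute_abs)
  then have lim: "((\<lambda>t. (\<phi> (u + t *\<^sub>R (z - u)) - \<phi> u) / t) \<longlongrightarrow> D (z - u)) (at 0 within {0..1})"
    by (simp add: has_field_derivative_iff)
  have "\<phi> z - \<phi> u \<le> (\<phi> (u + t *\<^sub>R (z - u)) - \<phi> u) / t" if t: "t \<in> {0..1}" "t \<noteq> 0" for t
  proof -
    have "(1 - t) * \<phi> u + t * \<phi> z \<le> \<phi> ((1 - t) *\<^sub>R u + t *\<^sub>R z)"
      using concave_onD[OF conc, of t u z] t S by auto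
    then have "t * (\<phi> z - \<phi> u) \<le> \<phi> (u + t *\<^sub>R (z - u)) - \<phi> u"
      by (simp add: algebra_simps)
    then show ?thesis
      using t by (simp add: field_simps)
  qed
  then have ev: "\<forall>\<^sub>F t in at 0 within {0..1}. \<phi> z - \<phi> u \<le> (\<phi> (u + t *\<^sub>R (z - u)) - \<phi> u) / t"
    by (auto simp: eventually_at_filter)
  have "\<phi> z - \<phi> u \<le> D (z - u)"
    by (rule tendsto_lowerbound[OF lim ev]) (simp add: at_within_Icc_at_right)
  then show ?thesis
    by simp
qed

section \<open>Cocoercivity of gradients of concave functions\<close>

text \<open>The points in \<open>inS\<close> are those at which \<open>\<phi>\<close> has to be
  evaluated. Each yields an inequality with constant \<open>1 / (2 * L)\<close>; adding the two
  cancels the values of \<open>\<phi>\<close>.\<close>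

lemma concave_gradient_cocoercive_local:
  fixes \<phi> :: "'a::real_inner \<Rightarrow> real"
  assumes S: "convex S" and conc: "concave_on S \<phi>" and L: "L > 0"
    and der: "\<And>p. p \<in> S \<Longrightarrow> (\<phi> has_derivative (\<lambda>h. g p \<bullet> h)) (at p within S)"
    and lip: "\<And>p q. p \<in> S \<Longrightarrow> q \<in> S \<Longrightarrow> norm (g p - g q) \<le> L * norm (p - q)"
    and uv: "u \<in> S" "v \<in> S"
    and inS: "u + (1 / L) *\<^sub>R (g u - g v) \<in> S" "v + (1 / L) *\<^sub>R (g v - g u) \<in> S"
  shows "(g u - g v) \<bullet> (u - v) \<le> - (1 / L) * (norm (g u - g v))\<^sup>2"
proof -
  \<comment> \<open>At the trial point the quadratic lower bound from \<open>u\<close> meets the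
    tangent upper bound from \<open>v\<close>. With \<open>w = g u - g v\<close>, the factor
    \<open>t = 1 / L\<close> maximizes the resulting gain
    \<open>(t - L * t^2 / 2) * (norm w)^2\<close>.\<close>
  have half: "\<phi> u - \<phi> v - g v \<bullet> (u - v) \<le> - (1 / (2 * L)) * (norm (g u - g v))\<^sup>2"
    if u: "u \<in> S" and v: "v \<in> S" and z: "u + (1 / L) *\<^sub>R (g u - g v) \<in> S" for u v
  proof -
    define w where "w = g u - g v"
    have "- \<phi> (u + (1 / L) *\<^sub>R w) \<le> - \<phi> u + - g u \<bullet> (u + (1 / L) *\<^sub>R w - u)
            + L / 2 * (norm (u + (1 / L) *\<^sub>R w - u))\<^sup>2"
    proof (rule lipschitz_gradient_quadratic_upper_bound[OF S u z[folded w_def],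
            where \<phi> = "\<lambda>p. - \<phi> p" and g = "\<lambda>p. - g p"])
      show "((\<lambda>p. - \<phi> p) has_derivative (\<lambda>h. - g p \<bullet> h)) (at p within S)" if "p \<in> S" for p
        using has_derivative_minus[OF der[OF that]] by simp
      show "norm (- g p - - g q) \<le> L * norm (p - q)" if "p \<in> S" "q \<in> S" for p q
        using lip[OF that] by (simp add: norm_minus_commute)
    qed
    then have low: "\<phi> u + (g u \<bullet> w) / L - (norm w)\<^sup>2 / (2 * L) \<le> \<phi> (u + (1 / L) *\<^sub>R w)"
      using L by (simp add: power_divide) (simp add: power2_eq_square)
    have "\<phi> (u + (1 / L) *\<^sub>R w) \<le> \<phi> v + g v \<bullet> (u + (1 / L) *\<^sub>R w - v)"
      by (rule concave_below_tangent[OF S v z[folded w_def] conc der[OF v]])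
    then have up: "\<phi> (u + (1 / L) *\<^sub>R w) \<le> \<phi> v + g v \<bullet> (u - v) + (g v \<bullet> w) / L"
      by (simp add: inner_diff_right inner_add_right)
    have "(norm w)\<^sup>2 = g u \<bullet> w - g v \<bullet> w"
      by (simp add: w_def power2_norm_eq_inner inner_diff_left)
    then have "(norm w)\<^sup>2 / L = (g u \<bullet> w) / L - (g v \<bullet> w) / L"
      by (simp add: diff_divide_distrib)
    with low up show ?thesis
      by (simp add: w_def)
  qed
  have "\<phi> u - \<phi> v - g v \<bullet> (u - v) + (\<phi> v - \<phi> u - g u \<bullet> (v - u))
        \<le> - (1 / (2 * L)) * (norm (g u - g v))\<^sup>2 + - (1 / (2 * L)) * (norm (g u - g v))\<^sup>2"
    using half[OF uv inS(1)] half[OF uv(2,1) inS(2)]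
    by (simp only: norm_minus_commute[of "g v" "g u"] add_mono)
  then show ?thesis
    by (simp add: inner_diff_left inner_diff_right)
qed

text \<open>Expanding the square exhibits \<open>4 / L\<close> times the cocoercivity defect. Unlike
  cocoercivity, nonexpansiveness chains through the triangle inequality.\<close>

lemma cocoercive_iff_nonexpansive:
  fixes e w :: "'a::real_inner"
  assumes "L > 0"
  shows "w \<bullet> e \<le> - (1 / L) * (norm w)\<^sup>2 \<longleftrightarrow> norm (e + (2 / L) *\<^sub>R w) \<le> norm e"
proof -
  have shift: "a + 4 / L * b \<le> a \<longleftrightarrow> b \<le> 0" for a b :: real
    using assms by (simp add: divide_le_0_iff)
  have "norm (e + (2 / L) *\<^sub>R w) \<le> norm e \<longleftrightarrow> (norm (e + (2 / L) *\<^sub>R w))\<^sup>2 \<le> (norm e)\<^sup>2"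
    by simp
  also have "(norm (e + (2 / L) *\<^sub>R w))\<^sup>2 = (norm e)\<^sup>2 + 4 / L * (w \<bullet> e + 1 / L * (norm w)\<^sup>2)"
    by (simp add: power2_norm_eq_inner inner_add_left inner_add_right inner_commute[of e w] algebra_simps)
  also have "\<dots> \<le> (norm e)\<^sup>2 \<longleftrightarrow> w \<bullet> e + 1 / L * (norm w)\<^sup>2 \<le> 0"
    using shift .
  finally show ?thesis
    by auto
qed

lemma nonexpansive_by_subdivision:
  fixes T :: "'a::real_normed_vector \<Rightarrow> 'b::real_normed_vector"
  assumes r: "r > 0"
    and loc: "\<And>p q. p \<in> closed_segment u v \<Longrightarrow> q \<in> closed_segment u v \<Longrightarrow> norm (p - q) \<le> r \<Longrightarrow>
                norm (T p - T q) \<le> norm (p - q)"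
  shows "norm (T v - T u) \<le> norm (v - u)"
proof -
  \<comment> \<open>Enough pieces to make each shorter than \<open>r\<close>; the strict inequality
    forces \<open>n > 0\<close> even when \<open>u = v\<close>.\<close>
  obtain n where n: "norm (v - u) / r < real n"
    using reals_Archimedean2 by blast
  then have n0: "n > 0"
    using r by (cases n) (auto simp: divide_less_0_iff not_less)
  define p where "p i = u + (real i / real n) *\<^sub>R (v - u)" for i
  have seg: "p i \<in> closed_segment u v" if "i \<le> n" for i
    unfolding closed_segment_def p_def using that n0
    by (auto intro!: exI[of _ "real i / real n"] simp: algebra_simps)
  have step: "p (Suc i) - p i = (1 / real n) *\<^sub>R (v - u)" for i
    by (simp add: p_def add_divide_distrib algebra_simps)
  have small: "norm (p (Suc i) - p i) \<le> r" for i
    using n n0 r by (simp add: step pos_divide_less_eq pos_divide_le_eq mult.commute del: scaleR_right_diff_distrib)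
  have "p 0 = u" "p n = v"
    using n0 by (simp_all add: p_def)
  then have "T v - T u = (\<Sum>i<n. T (p (Suc i)) - T (p i))"
    using sum_lessThan_telescope[of "\<lambda>i. T (p i)" n] by simp
  also have "norm \<dots> \<le> (\<Sum>i<n. norm (T (p (Suc i)) - T (p i)))"
    by (rule norm_sum)
  also have "\<dots> \<le> (\<Sum>i<n. norm (p (Suc i) - p i))"
    by (intro sum_mono loc seg small) auto
  also have "\<dots> = norm (v - u)"
    using n0 by (simp add: step)
  finally show ?thesis .
qed

text \<open>On the segment between two relative interior points one radius \<open>r\<close> works
  throughout, so the local result applies to points at distance at most \<open>r\<close>;
  subdivision then covers the segment.\<close>

lemma concave_gradient_cocoercive_rel_interior:
  fixes \<phi> :: "'a::euclidean_space \<Rightarrow> real"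
  assumes S: "convex S" and conc: "concave_on S \<phi>" and L: "L > 0"
    and der: "\<And>p. p \<in> S \<Longrightarrow> (\<phi> has_derivative (\<lambda>h. g p \<bullet> h)) (at p within S)"
    and lip: "\<And>p q. p \<in> S \<Longrightarrow> q \<in> S \<Longrightarrow> norm (g p - g q) \<le> L * norm (p - q)"
    and tangent: "\<And>p q a. p \<in> S \<Longrightarrow> q \<in> S \<Longrightarrow> a \<in> affine hull S \<Longrightarrow>
                    a + (1 / L) *\<^sub>R (g p - g q) \<in> affine hull S"
    and u: "u \<in> rel_interior S" and v: "v \<in> rel_interior S"
  shows "(g u - g v) \<bullet> (u - v) \<le> - (1 / L) * (norm (g u - g v))\<^sup>2"
proof -
  obtain r1 where r1: "r1 > 0" "cball u r1 \<inter> affine hull S \<subseteq> S"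
    using u by (auto simp: mem_rel_interior_cball)
  obtain r2 where r2: "r2 > 0" "cball v r2 \<inter> affine hull S \<subseteq> S"
    using v by (auto simp: mem_rel_interior_cball)
  define r where "r = min r1 r2"
  have r: "r > 0" "r \<le> r1" "r \<le> r2"
    using r1 r2 by (auto simp: r_def)
  have uv: "u \<in> S" "v \<in> S"
    using u v rel_interior_subset by auto
  then have aff: "u \<in> affine hull S" "v \<in> affine hull S"
    by (simp_all add: hull_inc)
  have seg: "closed_segment u v \<subseteq> S"
    using closed_segment_subset[OF uv S] .
  \<comment> \<open>\<open>p + h\<close> is the same convex combination of \<open>u + h\<close> and
    \<open>v + h\<close> as \<open>p\<close> is of \<open>u\<close> and \<open>v\<close>, so the
    balls at the two endpoints suffice.\<close>
  have shift: "p + h \<in> S"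
    if p: "p \<in> closed_segment u v" and h: "norm h \<le> r" and hu: "u + h \<in> affine hull S" "v + h \<in> affine hull S" for p h
  proof -
    obtain t where t: "0 \<le> t" "t \<le> 1" "p = (1 - t) *\<^sub>R u + t *\<^sub>R v"
      using p by (auto simp: closed_segment_def)
    have "u + h \<in> S" "v + h \<in> S"
      using r1 r2 r h hu by (auto simp: dist_norm)
    then have "(1 - t) *\<^sub>R (u + h) + t *\<^sub>R (v + h) \<in> S"
      using convexD_alt[OF S] t by blast
    then show ?thesis
      by (simp add: t algebra_simps)
  qed
  define T where "T p = p + (2 / L) *\<^sub>R g p" for p
  have local: "norm (T p - T q) \<le> norm (p - q)"
    if p: "p \<in> closed_segment u v" and q: "q \<in> closed_segment u v" and pq: "norm (p - q) \<le> r" for p q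
  proof -
    have S': "p \<in> S" "q \<in> S"
      using p q seg by auto
    have small: "norm ((1 / L) *\<^sub>R (g a - g b)) \<le> r" if "a \<in> S" "b \<in> S" "norm (a - b) \<le> r" for a b
    proof -
      have "norm ((1 / L) *\<^sub>R (g a - g b)) \<le> norm (a - b)"
        using lip[OF that(1,2)] L
        by (simp add: pos_divide_le_eq mult.commute del: scaleR_right_diff_distrib)
      then show ?thesis
        using that by simp
    qed
    have "p + (1 / L) *\<^sub>R (g p - g q) \<in> S"
      using small S' pq by (intro shift p tangent aff)
    moreover have "q + (1 / L) *\<^sub>R (g q - g p) \<in> S"
      using small S' pq by (intro shift q tangent aff) (simp_all add: norm_minus_commute)
    ultimately have "(g p - g q) \<bullet> (p - q) \<le> - (1 / L) * (norm (g p - g q))\<^sup>2"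
      by (intro concave_gradient_cocoercive_local[OF S conc L der lip S'])
    then have "norm (p - q + (2 / L) *\<^sub>R (g p - g q)) \<le> norm (p - q)"
      by (simp only: cocoercive_iff_nonexpansive[OF L])
    then show ?thesis
      by (simp add: T_def algebra_simps)
  qed
  have "norm (T v - T u) \<le> norm (v - u)"
    by (rule nonexpansive_by_subdivision[OF r(1) local])
  then have "norm (u - v + (2 / L) *\<^sub>R (g u - g v)) \<le> norm (u - v)"
    by (simp add: T_def norm_minus_commute[of v u] norm_minus_commute[of "v + _"] algebra_simps)
  then show ?thesis
    by (simp only: cocoercive_iff_nonexpansive[OF L])
qed

text \<open>The relative interior of a convex set is dense in it and \<open>g\<close> is Lipschitz,
  so both sides pass to the limit.\<close>

lemma concave_gradient_cocoercive_tangent: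
  fixes \<phi> :: "'a::euclidean_space \<Rightarrow> real"
  assumes S: "convex S" and conc: "concave_on S \<phi>" and L: "L > 0"
    and der: "\<And>p. p \<in> S \<Longrightarrow> (\<phi> has_derivative (\<lambda>h. g p \<bullet> h)) (at p within S)"
    and lip: "\<And>p q. p \<in> S \<Longrightarrow> q \<in> S \<Longrightarrow> norm (g p - g q) \<le> L * norm (p - q)"
    and tangent: "\<And>p q a. p \<in> S \<Longrightarrow> q \<in> S \<Longrightarrow> a \<in> affine hull S \<Longrightarrow>
                    a + (1 / L) *\<^sub>R (g p - g q) \<in> affine hull S"
    and u: "u \<in> S" and v: "v \<in> S"
  shows "(g u - g v) \<bullet> (u - v) \<le> - (1 / L) * (norm (g u - g v))\<^sup>2"
proof -
  have approx: "\<exists>a. (\<forall>n. a n \<in> rel_interior S) \<and> a \<longlonglongrightarrow> p" if "p \<in> S" for p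
    using that closure_subset[of S] convex_closure_rel_interior[OF S]
    by (metis closure_sequential subsetD)
  obtain a where a: "\<And>n. a n \<in> rel_interior S" "a \<longlonglongrightarrow> u"
    using approx[OF u] by blast
  obtain b where b: "\<And>n. b n \<in> rel_interior S" "b \<longlonglongrightarrow> v"
    using approx[OF v] by blast
  have "L-lipschitz_on S g"
    using lip L by (intro lipschitz_onI) (auto simp: dist_norm)
  then have cont: "continuous_on S g"
    by (rule lipschitz_on_continuous_on)
  have ga: "(\<lambda>n. g (a n)) \<longlonglongrightarrow> g u"
    using a rel_interior_subset
    by (intro continuous_on_tendsto_compose[OF cont a(2) u]) (auto intro!: always_eventually)
  have gb: "(\<lambda>n. g (b n)) \<longlonglongrightarrow> g v"
    using b rel_interior_subset
    by (intro continuous_on_tendsto_compose[OF cont b(2) v]) (auto intro!: always_eventually)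
  show ?thesis
  proof (rule tendsto_le[OF sequentially_bot])
    show "(\<lambda>n. (g (a n) - g (b n)) \<bullet> (a n - b n)) \<longlonglongrightarrow> (g u - g v) \<bullet> (u - v)"
      by (intro tendsto_intros ga gb a b)
    show "(\<lambda>n. - (1 / L) * (norm (g (a n) - g (b n)))\<^sup>2) \<longlonglongrightarrow> - (1 / L) * (norm (g u - g v))\<^sup>2"
      by (intro tendsto_intros ga gb)
    show "\<forall>\<^sub>F n in sequentially. (g (a n) - g (b n)) \<bullet> (a n - b n) \<le> - (1 / L) * (norm (g (a n) - g (b n)))\<^sup>2"
      by (intro always_eventually allI
            concave_gradient_cocoercive_rel_interior[OF S conc L der lip tangent a(1) b(1)])
  qed
qed

text \<open>
  On a set of lower dimension only the component of \<open>g\<close> tangent to the affine hull is determined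
  by \<open>\<phi>\<close>, and nonexpansiveness can fail in the orthogonal directions; hence \<open>d\<close> is tangent.
\<close>

lemma concave_gradient_step_nonexpansive:
  fixes \<phi> :: "'a::euclidean_space \<Rightarrow> real"
  assumes S: "convex S" and conc: "concave_on S \<phi>" and L: "L > 0"
    and der: "\<And>p. p \<in> S \<Longrightarrow> (\<phi> has_derivative (\<lambda>h. g p \<bullet> h)) (at p within S)"
    and lip: "\<And>p q. p \<in> S \<Longrightarrow> q \<in> S \<Longrightarrow> norm (g p - g q) \<le> L * norm (p - q)"
    and c: "c \<ge> 0" and \<rho>: "\<rho> > 0" "\<rho> * (L + 2 * c) \<le> 2"
    and u: "u \<in> S" and v: "v \<in> S" and d: "d \<in> span ((\<lambda>p. p - v) ` S)"
  shows "(u - v + \<rho> *\<^sub>R (g u - g v - c *\<^sub>R (u - v))) \<bullet> d \<le> norm (u - v) * norm d"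
proof -
  define V where "V = span ((\<lambda>p. p - v) ` S)"
  have subV: "subspace V"
    by (simp add: V_def)
  \<comment> \<open>The witness is the orthogonal projection of \<open>w\<close> onto
    \<open>V\<close>, the direction space of the affine hull.\<close>
  have "\<exists>a. a \<in> V \<and> (\<forall>h\<in>V. a \<bullet> h = w \<bullet> h)" for w
  proof -
    obtain a b where "a \<in> V" "\<And>h. h \<in> V \<Longrightarrow> orthogonal b h" "w = a + b"
      using orthogonal_subspace_decomp_exists[of "(\<lambda>p. p - v) ` S" w] unfolding V_def by metis
    then show ?thesis
      by (auto simp: inner_add_left orthogonal_def)
  qed
  then obtain P where PV: "\<And>w. P w \<in> V" and Ph: "\<And>w h. h \<in> V \<Longrightarrow> P w \<bullet> h = w \<bullet> h"
    by metis
  have PdiffV: "P w - P w' \<in> V" for w w'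
    using PV subV by (simp add: subspace_diff)
  have Pnorm: "norm (P w - P w') \<le> norm (w - w')" for w w'
  proof -
    have "(norm (P w - P w'))\<^sup>2 = (w - w') \<bullet> (P w - P w')"
      by (simp add: power2_norm_eq_inner Ph[OF PdiffV] inner_diff_left)
    also have "\<dots> \<le> norm (w - w') * norm (P w - P w')"
      by (rule norm_cauchy_schwarz)
    finally show ?thesis
      by (cases "norm (P w - P w') = 0") (auto simp: power2_eq_square)
  qed
  have diffV: "p - q \<in> V" if "p \<in> S" "q \<in> S" for p q
  proof -
    have "(p - v) - (q - v) \<in> V"
      unfolding V_def using that by (intro span_diff span_base) auto
    then show ?thesis
      by simp
  qed
  have aff: "affine hull S = (\<lambda>h. v + h) ` V"
    unfolding V_def using affine_hull_span_gen[OF hull_inc[OF v]] by simp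
  \<comment> \<open>The tangential part of \<open>g\<close> is still a gradient of
    \<open>\<phi>\<close> within \<open>S\<close>, since only differences of points of
    \<open>S\<close> enter the limit, and it inherits the constant \<open>L\<close> because
    \<open>P\<close> is nonexpansive.\<close>
  define q where "q p = P (g p)" for p
  have coc: "(q u - q v) \<bullet> (u - v) \<le> - (1 / L) * (norm (q u - q v))\<^sup>2"
  proof (rule concave_gradient_cocoercive_tangent[OF S conc L _ _ _ u v])
    show "(\<phi> has_derivative (\<lambda>h. q p \<bullet> h)) (at p within S)" if p: "p \<in> S" for p
    proof -
      have *: "((\<lambda>z. (\<phi> z - \<phi> p - g p \<bullet> (z - p)) /\<^sub>R norm (z - p)) \<longlongrightarrow> 0) (at p within S)"
        using der[OF p] by (simp add: has_derivative_at_within)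
      have "((\<lambda>z. (\<phi> z - \<phi> p - q p \<bullet> (z - p)) /\<^sub>R norm (z - p)) \<longlongrightarrow> 0) (at p within S)"
        by (rule Lim_transform_within[OF *, of 1]) (auto simp: q_def Ph diffV p)
      then show ?thesis
        by (simp add: has_derivative_at_within bounded_linear_inner_right)
    qed
    show "norm (q p - q p') \<le> L * norm (p - p')" if "p \<in> S" "p' \<in> S" for p p'
      unfolding q_def using Pnorm lip[OF that] by (rule order_trans)
    show "a + (1 / L) *\<^sub>R (q p - q p') \<in> affine hull S" if "a \<in> affine hull S" for a p p'
    proof -
      obtain h where h: "h \<in> V" "a = v + h"
        using \<open>a \<in> affine hull S\<close> aff by blast
      then have "h + (1 / L) *\<^sub>R (q p - q p') \<in> V"
        unfolding q_def by (intro subspace_add[OF subV] subspace_scale[OF subV] PdiffV)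
      then show ?thesis
        using h by (simp add: aff add.assoc image_iff)
    qed
  qed
  define e where "e = u - v"
  define w where "w = q u - q v"
  \<comment> \<open>\<open>s\<close> is the coefficient of \<open>e\<close> after absorbing the term
    \<open>- \<rho> * c\<close> from the regularization.\<close>
  define s where "s = 1 - \<rho> * c"
  have s1: "s \<le> 1"
    using c \<rho> by (simp add: s_def)
  have "\<rho> * L > 0"
    using \<rho> L by simp
  \<comment> \<open>The step size condition says \<open>\<rho> * L \<le> 2 * s\<close>. It makes
    \<open>s\<close> nonnegative, as needed to multiply cocoercivity by it, and lets the negative
    term absorb \<open>\<rho>^2 * (norm w)^2\<close>.\<close>
  then have s0: "s \<ge> 0" "\<rho> * L \<le> 2 * s"
    using \<rho>(2) by (simp_all add: s_def algebra_simps)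
  have "(norm (s *\<^sub>R e + \<rho> *\<^sub>R w))\<^sup>2 = s\<^sup>2 * (norm e)\<^sup>2 + 2 * s * \<rho> * (w \<bullet> e) + \<rho>\<^sup>2 * (norm w)\<^sup>2"
    unfolding power2_norm_eq_inner
    by (simp add: inner_add_left inner_add_right inner_commute[of e w] power2_eq_square algebra_simps)
  also have "2 * s * \<rho> * (w \<bullet> e) \<le> 2 * s * \<rho> * (- (1 / L) * (norm w)\<^sup>2)"
    using coc s0 \<rho> by (intro mult_left_mono) (auto simp: w_def e_def)
  also have "s\<^sup>2 * (norm e)\<^sup>2 \<le> 1 * (norm e)\<^sup>2"
    using s0 s1 by (intro mult_right_mono) (auto simp: power_le_one)
  also have "1 * (norm e)\<^sup>2 + 2 * s * \<rho> * (- (1 / L) * (norm w)\<^sup>2) + \<rho>\<^sup>2 * (norm w)\<^sup>2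
      = (norm e)\<^sup>2 - \<rho> / L * (2 * s - \<rho> * L) * (norm w)\<^sup>2"
    using L by (simp add: field_simps power2_eq_square)
  also have "\<dots> \<le> (norm e)\<^sup>2"
    using s0 \<rho> L by simp
  finally have le: "norm (s *\<^sub>R e + \<rho> *\<^sub>R w) \<le> norm e"
    by simp
  \<comment> \<open>Pairing with \<open>d\<close> in \<open>V\<close> does not see the difference
    between \<open>g\<close> and its tangential part.\<close>
  have "(u - v + \<rho> *\<^sub>R (g u - g v - c *\<^sub>R (u - v))) \<bullet> d = (s *\<^sub>R e + \<rho> *\<^sub>R w) \<bullet> d"
    using Ph[of d] d
    by (simp add: V_def s_def e_def w_def q_def inner_add_left inner_diff_left algebra_simps)
  also have "\<dots> \<le> norm (s *\<^sub>R e + \<rho> *\<^sub>R w) * norm d"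
    by (rule norm_cauchy_schwarz)
  also have "\<dots> \<le> norm e * norm d"
    using le by (rule mult_right_mono) simp
  finally show ?thesis
    by (simp add: e_def)
qed

section \<open>Partial derivatives of a smooth function on a product\<close>

lemma C1_with_gradients_partial_fst:
  assumes "C1_with_gradients f gx gy X Y" "u \<in> X" "v \<in> Y"
  shows "((\<lambda>u. f (u, v)) has_derivative (\<lambda>h. gx (u, v) \<bullet> h)) (at u within X)"
proof -
  have "(f has_derivative (\<lambda>(h, k). gx (u, v) \<bullet> h + gy (u, v) \<bullet> k)) (at (u, v) within X \<times> Y)"
    using assms by (auto simp: C1_with_gradients_def)
  moreover have "(\<lambda>u. (u, v)) ` X \<subseteq> X \<times> Y"
    using assms by auto
  ultimately have "(f has_derivative (\<lambda>(h, k). gx (u, v) \<bullet> h + gy (u, v) \<bullet> k))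
      (at (u, v) within (\<lambda>u. (u, v)) ` X)"
    by (rule has_derivative_subset)
  moreover have "((\<lambda>u. (u, v)) has_derivative (\<lambda>h. (h, 0))) (at u within X)"
    by (auto intro!: derivative_eq_intros)
  ultimately show ?thesis
    using has_derivative_in_compose by fastforce
qed

lemma C1_with_gradients_partial_snd:
  assumes "C1_with_gradients f gx gy X Y" "u \<in> X" "v \<in> Y"
  shows "((\<lambda>v. f (u, v)) has_derivative (\<lambda>k. gy (u, v) \<bullet> k)) (at v within Y)"
proof -
  have "(f has_derivative (\<lambda>(h, k). gx (u, v) \<bullet> h + gy (u, v) \<bullet> k)) (at (u, v) within X \<times> Y)"
    using assms by (auto simp: C1_with_gradients_def)
  moreover have "Pair u ` Y \<subseteq> X \<times> Y"
    using assms by auto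
  ultimately have "(f has_derivative (\<lambda>(h, k). gx (u, v) \<bullet> h + gy (u, v) \<bullet> k))
      (at (u, v) within Pair u ` Y)"
    by (rule has_derivative_subset)
  moreover have "(Pair u has_derivative (\<lambda>k. (0, k))) (at v within Y)"
    by (auto intro!: derivative_eq_intros)
  ultimately show ?thesis
    using has_derivative_in_compose by fastforce
qed

section \<open>The one-step estimate for the iteration\<close>

theorem lemma3p3:
  fixes X :: "(real ^ 'n) set" and Y :: "(real ^ 'm) set"
    and f :: "(real ^ 'n) \<times> (real ^ 'm) \<Rightarrow> real"
    and gx :: "(real ^ 'n) \<times> (real ^ 'm) \<Rightarrow> real ^ 'n"
    and gy :: "(real ^ 'n) \<times> (real ^ 'm) \<Rightarrow> real ^ 'm"
    and L11 L12 L21 L22 L22' \<eta> \<rho> :: real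
    and c \<beta> :: "nat \<Rightarrow> real"
    and x :: "nat \<Rightarrow> real ^ 'n" and y :: "nat \<Rightarrow> real ^ 'm"
  assumes "X \<noteq> {}" "closed X" "bounded X" "convex X"
    and "Y \<noteq> {}" "closed Y" "bounded Y" "convex Y"
    and "C1_with_gradients f gx gy X Y"
    and "\<And>u. u \<in> X \<Longrightarrow> concave_on Y (\<lambda>v. f (u, v))"
    and "L11 > 0" "L12 > 0" "L21 > 0" "L22 > 0"
    and "\<And>u u' v. u \<in> X \<Longrightarrow> u' \<in> X \<Longrightarrow> v \<in> Y \<Longrightarrow>
           norm (gx (u, v) - gx (u', v)) \<le> L11 * norm (u - u')"
    and "\<And>u v v'. u \<in> X \<Longrightarrow> v \<in> Y \<Longrightarrow> v' \<in> Y \<Longrightarrow>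
           norm (gx (u, v) - gx (u, v')) \<le> L21 * norm (v - v')"
    and "\<And>u v v'. u \<in> X \<Longrightarrow> v \<in> Y \<Longrightarrow> v' \<in> Y \<Longrightarrow>
           norm (gy (u, v) - gy (u, v')) \<le> L22 * norm (v - v')"
    and "\<And>u u' v. u \<in> X \<Longrightarrow> u' \<in> X \<Longrightarrow> v \<in> Y \<Longrightarrow>
           norm (gy (u, v) - gy (u', v)) \<le> L12 * norm (u - u')"
    and "\<And>k. k \<ge> 1 \<Longrightarrow> c k \<ge> 0"
    and "antimono_on {1..} c"
    and "\<eta> > 0" "\<rho> > 0"
    and "x 1 \<in> X" "y 1 \<in> Y"
    and "\<And>k. k \<ge> 1 \<Longrightarrow>
           x (k + 1) = closest_point X (x k - (1 / (\<eta> + \<beta> k)) *\<^sub>R gx (x k, y k))"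
    and "\<And>k. k \<ge> 1 \<Longrightarrow>
           y (k + 1) = closest_point Y (y k + \<rho> *\<^sub>R gy (x (k + 1), y k) - (\<rho> * c k) *\<^sub>R y k)"
    and "L22' = L22 + c 1"
    and "\<And>k. k \<ge> 1 \<Longrightarrow> \<beta> k > L11"
    and "\<rho> \<le> 2 / (L22' + c 1)"
  shows "\<forall>k\<ge>2.
    f (x (k + 1), y (k + 1)) - f (x k, y k)
      \<le> - (\<eta> + \<beta> k / 2 - \<rho> * L12\<^sup>2 / 2) * (norm (x (k + 1) - x k))\<^sup>2
        + 1 / \<rho> * (norm (y (k + 1) - y k))\<^sup>2
        + 1 / (2 * \<rho>) * (norm (y k - y (k - 1)))\<^sup>2
        + c (k - 1) / 2 * ((norm (y (k + 1)))\<^sup>2 - (norm (y k))\<^sup>2)"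
proof (intro allI impI)
  fix k :: nat
  assume k: "k \<ge> 2"
  note convX = \<open>convex X\<close> and convY = \<open>convex Y\<close>
  note C1 = \<open>C1_with_gradients f gx gy X Y\<close>
  note conc = assms(10) and lipx = assms(15) and lipy = assms(17) and lipyx = assms(18)
  note c_nonneg = assms(19)
  note xstep = assms(25) and ystep = assms(26)
  have xX: "x (Suc j) \<in> X" for j
    using xstep[of j] \<open>x 1 \<in> X\<close> \<open>closed X\<close> \<open>X \<noteq> {}\<close>
    by (cases j) (auto simp: closest_point_in_set)
  have yY: "y (Suc j) \<in> Y" for j
    using ystep[of j] \<open>y 1 \<in> Y\<close> \<open>closed Y\<close> \<open>Y \<noteq> {}\<close>
    by (cases j) (auto simp: closest_point_in_set)
  define x0 x1 y0 ym y1 where "x0 = x k" and "x1 = x (k + 1)"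
    and "y0 = y k" and "ym = y (k - 1)" and "y1 = y (k + 1)"
  note xy_defs = x0_def x1_def y0_def ym_def y1_def
  have inX: "x0 \<in> X" "x1 \<in> X"
    using xX[of "k - 1"] xX[of k] k by (auto simp: xy_defs)
  \<comment> \<open>Here \<open>k \<ge> 2\<close> matters: it makes \<open>k - 1\<close> at least 1,
    so that \<open>ym\<close> is a genuine iterate.\<close>
  have inY: "y0 \<in> Y" "ym \<in> Y" "y1 \<in> Y"
    using yY[of "k - 1"] yY[of "k - 2"] yY[of k] k
    by (auto simp: xy_defs Suc_diff_le numeral_2_eq_2 Suc_diff_Suc)
  define b where "b = \<eta> + \<beta> k"
  have \<beta>: "\<beta> k > L11"
    using assms(28)[of k] k by simp
  then have b: "b > 0"
    using \<open>\<eta> > 0\<close> \<open>L11 > 0\<close> by (simp add: b_def)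

  \<comment> \<open>Variational inequality of the projection defining \<open>x1\<close>, tested at
    \<open>x0\<close>.\<close>
  have "(x0 - (1 / b) *\<^sub>R gx (x0, y0) - x1) \<bullet> (x0 - x1) \<le> 0"
    using closest_point_dot[OF convX \<open>closed X\<close> inX(1), of "x0 - (1 / b) *\<^sub>R gx (x0, y0)"]
      xstep[of k] k by (simp add: xy_defs b_def)
  then have "(norm (x1 - x0))\<^sup>2 + (gx (x0, y0) \<bullet> (x1 - x0)) / b \<le> 0"
    by (simp add: norm_minus_commute[of x1] power2_norm_eq_inner inner_diff_left inner_diff_right
        diff_divide_distrib algebra_simps)
  then have proj_x: "gx (x0, y0) \<bullet> (x1 - x0) \<le> - b * (norm (x1 - x0))\<^sup>2"
    using b by (simp add: field_simps)
  have "f (x1, y0) \<le> f (x0, y0) + gx (x0, y0) \<bullet> (x1 - x0) + L11 / 2 * (norm (x1 - x0))\<^sup>2"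
    by (rule lipschitz_gradient_quadratic_upper_bound[OF convX inX, where g = "\<lambda>u. gx (u, y0)"])
      (use inY in \<open>auto intro: C1_with_gradients_partial_fst[OF C1] lipx\<close>)
  with proj_x have "f (x1, y0) - f (x0, y0) \<le> - (b - L11 / 2) * (norm (x1 - x0))\<^sup>2"
    by (simp add: algebra_simps)
  \<comment> \<open>\<open>\<beta> k > L11\<close> lets half of \<open>\<beta> k\<close> pay for the
    curvature term \<open>L11 / 2\<close>.\<close>
  also have "\<dots> \<le> - (\<eta> + \<beta> k / 2) * (norm (x1 - x0))\<^sup>2"
    using \<beta> by (intro mult_right_mono) (auto simp: b_def)
  finally have x_part: "f (x1, y0) - f (x0, y0) \<le> - (\<eta> + \<beta> k / 2) * (norm (x1 - x0))\<^sup>2" .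

  define d e where "d = y1 - y0" and "e = y0 - ym"
  \<comment> \<open>The index is \<open>k - 1\<close> because \<open>y0\<close> was produced by the
    previous projection.\<close>
  define cm where "cm = c (k - 1)"
  have cm: "cm \<ge> 0" "cm \<le> c 1"
    using c_nonneg[of "k - 1"] monotone_onD[OF \<open>antimono_on {1..} c\<close>, of 1 "k - 1"] k
    by (auto simp: cm_def)
  have \<rho>0: "\<rho> > 0" by fact
  have "\<rho> * (L22 + 2 * cm) \<le> \<rho> * (L22 + 2 * c 1)"
    using cm \<rho>0 by simp
  also have "\<dots> \<le> 2"
    using assms(27,29) \<open>L22 > 0\<close> cm by (simp add: pos_le_divide_eq add.assoc)
  finally have \<rho>: "\<rho> * (L22 + 2 * cm) \<le> 2" .

  have "f (x1, y1) \<le> f (x1, y0) + gy (x1, y0) \<bullet> d"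
    unfolding d_def
    by (rule concave_below_tangent[OF convY inY(1,3) conc[OF inX(2)]
          C1_with_gradients_partial_snd[OF C1 inX(2) inY(1)]])
  \<comment> \<open>The four terms are the change in \<open>x\<close>, the nonexpansive step at
    \<open>x0\<close>, the previous variational inequality, and the regularization remainder; the
    \<open>e\<close> and \<open>cm\<close> contributions cancel.\<close>
  moreover have "gy (x1, y0) \<bullet> d = (gy (x1, y0) - gy (x0, y0)) \<bullet> d
      + 1 / \<rho> * ((e + \<rho> *\<^sub>R (gy (x0, y0) - gy (x0, ym) - cm *\<^sub>R e)) \<bullet> d)
      + 1 / \<rho> * ((\<rho> *\<^sub>R gy (x0, ym) - (\<rho> * cm) *\<^sub>R ym - e) \<bullet> d) + cm * (y0 \<bullet> d)"
    using \<rho>0 by (simp add: e_def inner_add_left inner_diff_left field_simps)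
  moreover have "(gy (x1, y0) - gy (x0, y0)) \<bullet> d
      \<le> \<rho> * L12\<^sup>2 / 2 * (norm (x1 - x0))\<^sup>2 + 1 / (2 * \<rho>) * (norm d)\<^sup>2"
  proof -
    have "(gy (x1, y0) - gy (x0, y0)) \<bullet> d \<le> norm (gy (x1, y0) - gy (x0, y0)) * norm d"
      by (rule norm_cauchy_schwarz)
    also have "\<dots> \<le> L12 * norm (x1 - x0) * norm d"
      using lipyx inX inY by (intro mult_right_mono) auto
    \<comment> \<open>Young's inequality as a completed square, weighted by \<open>\<rho>\<close> to
      match the target coefficients.\<close>
    also have "\<dots> = \<rho> * L12\<^sup>2 / 2 * (norm (x1 - x0))\<^sup>2 + 1 / (2 * \<rho>) * (norm d)\<^sup>2
        - 1 / (2 * \<rho>) * (\<rho> * L12 * norm (x1 - x0) - norm d)\<^sup>2"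
      using \<rho>0 by (simp add: power2_eq_square field_simps)
    finally show ?thesis
      using \<rho>0 by (smt (verit) zero_le_power2 divide_nonneg_pos mult_nonneg_nonneg)
  qed
  moreover have "1 / \<rho> * ((e + \<rho> *\<^sub>R (gy (x0, y0) - gy (x0, ym) - cm *\<^sub>R e)) \<bullet> d)
      \<le> 1 / (2 * \<rho>) * (norm e)\<^sup>2 + 1 / (2 * \<rho>) * (norm d)\<^sup>2"
  proof -
    \<comment> \<open>Written as a difference of two generators, \<open>d\<close> is seen to be
      tangent to the affine hull of \<open>Y\<close>.\<close>
    have "(y1 - ym) - (y0 - ym) \<in> span ((\<lambda>p. p - ym) ` Y)"
      using inY by (intro span_diff span_base) auto
    then have "d \<in> span ((\<lambda>p. p - ym) ` Y)"
      by (simp add: d_def)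
    from concave_gradient_step_nonexpansive[OF convY conc[OF inX(1)] \<open>L22 > 0\<close>
        C1_with_gradients_partial_snd[OF C1 inX(1)] lipy[OF inX(1)] cm(1) \<rho>0 \<rho> inY(1,2) this]
    have "(e + \<rho> *\<^sub>R (gy (x0, y0) - gy (x0, ym) - cm *\<^sub>R e)) \<bullet> d \<le> norm e * norm d"
      by (simp add: e_def)
    also have "\<dots> \<le> ((norm e)\<^sup>2 + (norm d)\<^sup>2) / 2"
      using sum_squares_bound[of "norm e" "norm d"] by simp
    finally show ?thesis
      using \<rho>0 by (simp add: field_simps)
  qed
  moreover have "1 / \<rho> * ((\<rho> *\<^sub>R gy (x0, ym) - (\<rho> * cm) *\<^sub>R ym - e) \<bullet> d) \<le> 0"
  proof -
    have "y0 = closest_point Y (ym + \<rho> *\<^sub>R gy (x0, ym) - (\<rho> * cm) *\<^sub>R ym)"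
      using ystep[of "k - 1"] k by (simp add: xy_defs cm_def)
    \<comment> \<open>Variational inequality of the projection defining \<open>y0\<close>, tested at
      the next iterate \<open>y1\<close>.\<close>
    then have "(ym + \<rho> *\<^sub>R gy (x0, ym) - (\<rho> * cm) *\<^sub>R ym - y0) \<bullet> (y1 - y0) \<le> 0"
      using closest_point_dot[OF convY \<open>closed Y\<close> inY(3)] by metis
    then have "(\<rho> *\<^sub>R gy (x0, ym) - (\<rho> * cm) *\<^sub>R ym - e) \<bullet> d \<le> 0"
      by (simp add: d_def e_def algebra_simps)
    then show ?thesis
      using \<rho>0 by (simp add: divide_nonpos_pos)
  qed
  moreover have "cm * (y0 \<bullet> d) \<le> cm / 2 * ((norm y1)\<^sup>2 - (norm y0)\<^sup>2)"
  proof -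
    have "(norm y1)\<^sup>2 - (norm y0)\<^sup>2 = 2 * (y0 \<bullet> d) + (norm d)\<^sup>2"
      by (simp add: d_def power2_norm_eq_inner inner_diff_left inner_diff_right inner_commute)
    then have "y0 \<bullet> d \<le> ((norm y1)\<^sup>2 - (norm y0)\<^sup>2) / 2"
      by simp
    from mult_left_mono[OF this cm(1)] show ?thesis
      by simp
  qed
  moreover have "- (\<eta> + \<beta> k / 2 - \<rho> * L12\<^sup>2 / 2) * (norm (x1 - x0))\<^sup>2
      = - (\<eta> + \<beta> k / 2) * (norm (x1 - x0))\<^sup>2 + \<rho> * L12\<^sup>2 / 2 * (norm (x1 - x0))\<^sup>2"
    by (simp only: left_diff_distrib minus_diff_eq mult_minus_left)
  \<comment> \<open>One half comes from the change in \<open>x\<close>, the other from the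
    nonexpansive step.\<close>
  moreover have "1 / \<rho> * (norm d)\<^sup>2 = 1 / (2 * \<rho>) * (norm d)\<^sup>2 + 1 / (2 * \<rho>) * (norm d)\<^sup>2"
    by simp
  ultimately have "f (x1, y1) - f (x0, y0)
      \<le> - (\<eta> + \<beta> k / 2 - \<rho> * L12\<^sup>2 / 2) * (norm (x1 - x0))\<^sup>2 + 1 / \<rho> * (norm d)\<^sup>2
        + 1 / (2 * \<rho>) * (norm e)\<^sup>2 + cm / 2 * ((norm y1)\<^sup>2 - (norm y0)\<^sup>2)"
    using x_part by linarith
  then show "f (x (k + 1), y (k + 1)) - f (x k, y k)
      \<le> - (\<eta> + \<beta> k / 2 - \<rho> * L12\<^sup>2 / 2) * (norm (x (k + 1) - x k))\<^sup>2
        + 1 / \<rho> * (norm (y (k + 1) - y k))\<^sup>2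
        + 1 / (2 * \<rho>) * (norm (y k - y (k - 1)))\<^sup>2
        + c (k - 1) / 2 * ((norm (y (k + 1)))\<^sup>2 - (norm (y k))\<^sup>2)"
    by (simp only: xy_defs d_def e_def cm_def)
qed

end
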